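(* Let $K\subset\mathbb C^n$ be a non-pluripolar compact set, let $\psi:K\to\mathbb R$ be bounded, and suppose that $\Lambda=\Lambda(K,\psi)$ is nonempty (so that $\Lambda$ is either $(0,\infty)$ or $[\lambda,\infty)$ for some $\lambda>0$). (i) If $\Lambda=[\lambda,\infty)$ with $\lambda>0$, then $\Lambda_{\mathrm{reg}}(a;K,\psi)\in\{\varnothing,\{\lambda\},[\lambda,\infty)\}$ for every $a\in K$, and likewise $\Lambda_{\mathrm{reg}}(K,\psi)\in\{\varnothing,\{\lambda\},[\lambda,\infty)\}$. (ii) If $\Lambda=(0,\infty)$, then each of the sets $\Lambda_{\mathrm{reg}}(a;K,\psi)$ ($a\in K$) and $\Lambda_{\mathrm{reg}}(K,\psi)$ is either empty or equal to $(0,\infty)$.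
   Context: Write $\log^+t=\max\{\log t,0\}$, $\log^+0=0$; $\|\cdot\|$ is the Euclidean norm. For $\delta>0$, $\mathcal L_\delta=\{u\in \mathrm{PSH}(\mathbb C^n): u(z)\le\delta\log^+\|z\|+C_u \text{ on }\mathbb C^n\}$ for some constant $C_u$. For a function $f$, $f^*(z)=\limsup_{\zeta\to z}f(\zeta)$ is its upper semicontinuous regularization. For compact $K$ and bounded $\psi:K\to\mathbb R$, $V_{\delta,K,\psi}(z)=\sup\{u(z):u\in\mathcal L_\delta,\ u\le\psi\text{ on }K\}$ and $F_\delta=V_{\delta,K,\psi}^*$. Put $\Lambda(K,\psi)=\{\delta>0:V_{\delta,K,\psi}|_K=\psi\}$, $\Lambda_{\mathrm{reg}}(a;K,\psi)=\{\delta\in\Lambda(K,\psi):F_\delta(a)=\psi(a)\}$ for $a\in K$, and $\Lambda_{\mathrm{reg}}(K,\psi)=\{\delta\in\Lambda(K,\psi):F_\delta|_K=\psi\}$. A set is pluripolar if near each point it is contained in the $-\infty$ locus of a plurisubharmonic function not identically $-\infty$. It is known that a nonempty $\Lambda(K,\psi)$ is either $(0,\infty)$ or $[\lambda,\infty)$ for some $\lambda>0$. *)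

theory Defs
  imports "HOL-Analysis.Analysis"
begin

definition usc_on :: "'a::topological_space set \<Rightarrow> ('a \<Rightarrow> ereal) \<Rightarrow> bool" where
  "usc_on S u \<longleftrightarrow> (\<forall>c. openin (top_of_set S) {z \<in> S. u z < c})"

(* Lebesgue integral of an extended real function, as integral of the positive part minus
   integral of the negative part (e2ennreal sends negative numbers to 0).  It is only used
   for functions bounded above on a finite measure space, so the minuend is finite and the
   value lies in [-\<infinity>, \<infinity>). *)
definition ereal_integral :: "'a measure \<Rightarrow> ('a \<Rightarrow> ereal) \<Rightarrow> ereal" where
  "ereal_integral M f =
     enn2ereal (\<integral>\<^sup>+ x. e2ennreal (f x) \<partial>M) - enn2ereal (\<integral>\<^sup>+ x. e2ennreal (- f x) \<partial>M)"

(* Plurisubharmonic: upper semicontinuous with values in [-\<infinity>, \<infinity>), and satisfying the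
   sub-mean value inequality on every closed disc of a complex line contained in \<Omega>, i.e.
   subharmonic or identically -\<infinity> along complex lines.  The function identically -\<infinity>
   is allowed. *)
definition psh_on :: "(complex ^ 'n) set \<Rightarrow> (complex ^ 'n \<Rightarrow> ereal) \<Rightarrow> bool" where
  "psh_on \<Omega> u \<longleftrightarrow> open \<Omega> \<and> usc_on \<Omega> u \<and> (\<forall>z\<in>\<Omega>. u z < \<infinity>) \<and>
     (\<forall>a b. (\<forall>\<zeta>. cmod \<zeta> \<le> 1 \<longrightarrow> a + \<zeta> *s b \<in> \<Omega>) \<longrightarrow>
        u a \<le> ereal_integral (uniform_measure lborel {0..2 * pi}) (\<lambda>t. u (a + cis t *s b)))"

(* Connectedness of U is essential: otherwise v could be -\<infinity> on the component of U
   containing a and finite on another one. *)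
definition pluripolar :: "(complex ^ 'n) set \<Rightarrow> bool" where
  "pluripolar E \<longleftrightarrow> (\<forall>a\<in>E. \<exists>U v. open U \<and> connected U \<and> a \<in> U \<and> psh_on U v \<and>
     (\<exists>z\<in>U. v z \<noteq> -\<infinity>) \<and> E \<inter> U \<subseteq> {z \<in> U. v z = -\<infinity>})"

definition log_plus :: "real \<Rightarrow> real" where
  "log_plus t = (if t = 0 then 0 else max (ln t) 0)"

definition Lelong_class :: "real \<Rightarrow> (complex ^ 'n \<Rightarrow> ereal) set" where
  "Lelong_class \<delta> =
     {u. psh_on UNIV u \<and> (\<exists>C::real. \<forall>z. u z \<le> ereal (\<delta> * log_plus (norm z) + C))}"

(* The limsup is over full (not punctured) neighbourhoods, so f \<le> usc_reg f. *)
definition usc_reg :: "('a::topological_space \<Rightarrow> ereal) \<Rightarrow> 'a \<Rightarrow> ereal" where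
  "usc_reg f z = Limsup (nhds z) f"

(* \<psi> is a total function of which only the values on K are used. *)
definition extremal_fun ::
  "real \<Rightarrow> (complex ^ 'n) set \<Rightarrow> (complex ^ 'n \<Rightarrow> real) \<Rightarrow> complex ^ 'n \<Rightarrow> ereal" where
  "extremal_fun \<delta> K \<psi> z = (SUP u \<in> {u \<in> Lelong_class \<delta>. \<forall>x\<in>K. u x \<le> ereal (\<psi> x)}. u z)"

definition extremal_fun_reg ::
  "real \<Rightarrow> (complex ^ 'n) set \<Rightarrow> (complex ^ 'n \<Rightarrow> real) \<Rightarrow> complex ^ 'n \<Rightarrow> ereal" where
  "extremal_fun_reg \<delta> K \<psi> = usc_reg (extremal_fun \<delta> K \<psi>)"

definition Lambda :: "(complex ^ 'n) set \<Rightarrow> (complex ^ 'n \<Rightarrow> real) \<Rightarrow> real set" where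
  "Lambda K \<psi> = {\<delta>. \<delta> > 0 \<and> (\<forall>x\<in>K. extremal_fun \<delta> K \<psi> x = ereal (\<psi> x))}"

definition Lambda_reg_at ::
  "complex ^ 'n \<Rightarrow> (complex ^ 'n) set \<Rightarrow> (complex ^ 'n \<Rightarrow> real) \<Rightarrow> real set" where
  "Lambda_reg_at a K \<psi> = {\<delta> \<in> Lambda K \<psi>. extremal_fun_reg \<delta> K \<psi> a = ereal (\<psi> a)}"

definition Lambda_reg :: "(complex ^ 'n) set \<Rightarrow> (complex ^ 'n \<Rightarrow> real) \<Rightarrow> real set" where
  "Lambda_reg K \<psi> = {\<delta> \<in> Lambda K \<psi>. \<forall>x\<in>K. extremal_fun_reg \<delta> K \<psi> x = ereal (\<psi> x)}"

end

theory Submission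
  imports Defs
begin

text \<open>
  Write \<open>V\<^sub>\<delta>\<close> for the extremal function and \<open>F\<^sub>\<delta>\<close> for its upper semicontinuous
  regularization, and fix \<open>a \<in> K\<close>. For every \<open>\<delta> \<in> \<Lambda>\<close> one has \<open>\<psi>(a) = V\<^sub>\<delta>(a) \<le> F\<^sub>\<delta>(a)\<close>, and both functions
  increase with \<open>\<delta>\<close>, so the equality \<open>F\<^sub>\<delta>(a) = \<psi>(a)\<close> passes to smaller elements of \<open>\<Lambda>\<close>. The
  theorem says that it also passes to larger ones as soon as \<open>\<delta>\<close> is not the minimum of \<open>\<Lambda>\<close>.

  The reason is that \<open>F\<^sub>\<delta>(a)\<close> is concave in \<open>\<delta>\<close>. Let \<open>\<mu> < \<delta> < \<nu>\<close> with
  \<open>\<delta> = t\<mu> + (1 - t)\<nu>\<close>, let \<open>v\<close> be a competitor for \<open>V\<^sub>\<mu>\<close> and \<open>u\<close> one for \<open>V\<^sub>\<nu>\<close>. Then \<open>tv + (1 - t)u\<close> is a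
  competitor for \<open>V\<^sub>\<delta>\<close>. If \<open>\<mu>, \<delta> \<in> \<Lambda>\<close> and \<open>F\<^sub>\<delta>(a) = \<psi>(a)\<close>, then concavity gives
  \<open>\<psi>(a) \<ge> t\<psi>(a) + (1 - t)F\<^sub>\<nu>(a)\<close>, that is, \<open>F\<^sub>\<nu>(a) \<le> \<psi>(a)\<close>. This last inequality is
  \<open>extremal_fun_reg_concavity\<close>.

  The difficulty is that the inequality \<open>tv + (1 - t)V\<^sub>\<nu> \<le> V\<^sub>\<delta>\<close> does not regularize termwise, because \<open>v\<close>
  is not lower semicontinuous. It is overcome by integrating over a small ball \<open>B\<close> around \<open>a\<close> on which
  \<open>V\<^sub>\<delta> \<le> \<psi>(a) + \<eta>\<close>. The value \<open>v(a)\<close>, which may be taken close to \<open>\<psi>(a)\<close>, is at most the mean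
  of \<open>v\<close> over \<open>B\<close>, so the mean over \<open>B\<close> of every competitor \<open>u\<close> for \<open>V\<^sub>\<nu>\<close> is at most
  \<open>N = (\<psi>(a) + \<eta> - tv(a)) / (1 - t)\<close>, a number close to \<open>\<psi>(a)\<close>. To pass from means back to values
  near \<open>a\<close>, uniformly in \<open>u\<close>, replace \<open>u\<close> by \<open>max u v\<close>. The fixed function \<open>v\<close> is integrable
  on \<open>B\<close> and minorizes \<open>u\<close>, so \<open>u\<close> cannot have a large negative integral over a thin
  part of \<open>B\<close>. Hence for \<open>z\<close> near \<open>a\<close> the mean of \<open>u\<close> over the slightly smaller ball around \<open>z\<close> tangent
  to \<open>B\<close> from inside exceeds \<open>N\<close> by arbitrarily little, and \<open>u(z)\<close> is at most this mean
  (\<open>psh_mean_control\<close>).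

  The mean value inequality on balls follows from the one on circles by integrating over the
  direction vector: multiplication by a unimodular scalar preserves Lebesgue measure.
\<close>

section \<open>Invariance of Lebesgue measure under orthogonal maps\<close>

lemma nn_integral_lborel_translation:
  fixes g :: "'a::euclidean_space \<Rightarrow> ennreal"
  assumes [measurable]: "g \<in> borel_measurable borel"
  shows "(\<integral>\<^sup>+x. g (c + x) \<partial>lborel) = (\<integral>\<^sup>+x. g x \<partial>lborel)"
proof -
  have "(\<integral>\<^sup>+x. g x \<partial>lborel) = (\<integral>\<^sup>+x. g x \<partial>distr lborel borel (\<lambda>x. c + 1 *\<^sub>R x))"
    by (subst lborel_affine[of 1 c]) (auto simp: density_1)
  then show ?thesis by (simp add: nn_integral_distr)
qed

lemma nn_integral_lborel_reflection:
  fixes g :: "'a::euclidean_space \<Rightarrow> ennreal"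
  assumes [measurable]: "g \<in> borel_measurable borel"
  shows "(\<integral>\<^sup>+x. g (c - x) \<partial>lborel) = (\<integral>\<^sup>+x. g x \<partial>lborel)"
proof -
  have "(\<integral>\<^sup>+x. g x \<partial>lborel) = (\<integral>\<^sup>+x. g x \<partial>distr lborel borel (\<lambda>x. c + (-1) *\<^sub>R x))"
    by (subst lborel_affine[of "-1" c]) (auto simp: density_1)
  then show ?thesis by (simp add: nn_integral_distr)
qed

text \<open>This is the classical proof that a translation invariant measure is unique up to a factor,
  applied to Lebesgue measure and its image under \<open>f\<close>: integrate \<open>g (f x) * h y\<close> in both variables and
  shift one variable by the other in turn. Choosing for \<open>h\<close> the indicator of the unit ball, which is
  itself invariant under \<open>f\<close>, makes the factor equal to one.\<close>

lemma nn_integral_orthogonal: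
  fixes f :: "'a::euclidean_space \<Rightarrow> 'a"
  assumes f: "orthogonal_transformation f" and g[measurable]: "g \<in> borel_measurable borel"
  shows "(\<integral>\<^sup>+x. g (f x) \<partial>lborel) = (\<integral>\<^sup>+x. g x \<partial>lborel)"
proof -
  define h :: "'a \<Rightarrow> ennreal" where "h = indicator (ball 0 1)"
  have [measurable]: "h \<in> borel_measurable borel"
    unfolding h_def by (intro borel_measurable_indicator) simp
  have lin: "linear f" using f by (rule orthogonal_transformation_linear)
  have [measurable]: "f \<in> borel_measurable borel"
    by (intro borel_measurable_continuous_onI linear_continuous_on) (use lin in \<open>simp add: linear_conv_bounded_linear\<close>)
  have hf: "h (f x) = h x" for x
    using f by (simp add: h_def indicator_def orthogonal_transformation_norm)
  obtain f' where f': "\<And>y. f (f' y) = y"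
    using orthogonal_transformation_surj[OF f] by (metis surjD)
  have "(\<integral>\<^sup>+x. g (f x) \<partial>lborel) * (\<integral>\<^sup>+y. h y \<partial>lborel)
      = (\<integral>\<^sup>+x. (\<integral>\<^sup>+y. g (f x) * h y \<partial>lborel) \<partial>lborel)"
    by (simp add: nn_integral_cmult nn_integral_multc)
  also have "\<dots> = (\<integral>\<^sup>+x. (\<integral>\<^sup>+y. g (f x) * h (f x + y) \<partial>lborel) \<partial>lborel)"
    by (simp add: nn_integral_cmult nn_integral_lborel_translation[where g=h])
  also have "\<dots> = (\<integral>\<^sup>+y. (\<integral>\<^sup>+x. g (f x) * h (f x + y) \<partial>lborel) \<partial>lborel)"
    by (rule lborel_pair.Fubini') measurable
  also have "\<dots> = (\<integral>\<^sup>+y. (\<integral>\<^sup>+x. g (f x - y) * h (f x) \<partial>lborel) \<partial>lborel)"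
  proof (rule nn_integral_cong)
    fix y
    have "(\<integral>\<^sup>+x. g (f x) * h (f x + y) \<partial>lborel)
        = (\<integral>\<^sup>+x. g (f (- f' y + x)) * h (f (- f' y + x) + y) \<partial>lborel)"
      by (rule nn_integral_lborel_translation[symmetric]) measurable
    moreover have "f (- f' y + x) = f x - y" for x
      using lin by (simp add: linear_add linear_neg linear_diff f')
    ultimately show "(\<integral>\<^sup>+x. g (f x) * h (f x + y) \<partial>lborel) = (\<integral>\<^sup>+x. g (f x - y) * h (f x) \<partial>lborel)"
      by simp
  qed
  also have "\<dots> = (\<integral>\<^sup>+x. (\<integral>\<^sup>+y. g (f x - y) * h (f x) \<partial>lborel) \<partial>lborel)"
    by (rule lborel_pair.Fubini') measurable
  also have "\<dots> = (\<integral>\<^sup>+x. g x \<partial>lborel) * (\<integral>\<^sup>+y. h y \<partial>lborel)"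
    by (simp add: nn_integral_cmult nn_integral_multc hf nn_integral_lborel_reflection)
  finally have eq: "(\<integral>\<^sup>+x. g (f x) \<partial>lborel) * (\<integral>\<^sup>+y. h y \<partial>lborel)
      = (\<integral>\<^sup>+x. g x \<partial>lborel) * (\<integral>\<^sup>+y. h y \<partial>lborel)" .
  have "emeasure lborel (ball (0::'a) 1) \<noteq> 0" "emeasure lborel (ball (0::'a) 1) \<noteq> \<infinity>"
    using content_ball_pos[of 1 "0::'a"] emeasure_lborel_ball_finite[of "0::'a" 1]
    by (auto simp: measure_def)
  moreover have "(\<integral>\<^sup>+y. h y \<partial>lborel) = emeasure lborel (ball (0::'a) 1)"
    unfolding h_def by (rule nn_integral_indicator) simp
  ultimately show ?thesis
    using eq by (metis ennreal_mult_cancel_left infinity_ennreal_def mult.commute)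
qed

section \<open>Integrals of extended real functions that are bounded above\<close>

text \<open>Below a bound \<open>C\<close> the function is determined by its nonnegative defect \<open>C - f\<close>. Working with the
  defect makes additivity and Tonelli's theorem available even where \<open>f = -\<infinity>\<close>.\<close>

lemma ereal_integral_eq_bound_minus:
  assumes M: "emeasure M (space M) = 1" and f[measurable]: "f \<in> borel_measurable M"
    and le: "\<And>x. x \<in> space M \<Longrightarrow> f x \<le> ereal C"
  shows "ereal_integral M f = ereal C - enn2ereal (\<integral>\<^sup>+x. e2ennreal (ereal C - f x) \<partial>M)"
proof -
  let ?I = "\<integral>\<^sup>+x. e2ennreal (ereal C - f x) \<partial>M"
  let ?P = "\<integral>\<^sup>+x. e2ennreal (f x) \<partial>M"
  let ?N = "\<integral>\<^sup>+x. e2ennreal (- f x) \<partial>M"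
  \<comment> \<open>At most one of \<open>ennreal C\<close> and \<open>ennreal (- C)\<close> is nonzero, so the identity covers both signs of \<open>C\<close>.\<close>
  have pt: "e2ennreal (ereal C - y) + e2ennreal y + ennreal (- C) = ennreal C + e2ennreal (- y)"
    if "y \<le> ereal C" for y
  proof (cases y)
    case (real r)
    with that show ?thesis
      by (cases "r \<ge> 0"; cases "C \<ge> 0") (auto simp: ennreal_neg simp flip: ennreal_plus)
  qed (use that in auto)
  have "?I + ?P + ennreal (- C) = (\<integral>\<^sup>+x. e2ennreal (ereal C - f x) + e2ennreal (f x) + ennreal (- C) \<partial>M)"
    by (simp add: nn_integral_add M)
  also have "\<dots> = (\<integral>\<^sup>+x. ennreal C + e2ennreal (- f x) \<partial>M)"
    by (intro nn_integral_cong pt le)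
  also have "\<dots> = ennreal C + ?N"
    by (simp add: nn_integral_add M)
  finally have eq: "?I + ?P + ennreal (- C) = ennreal C + ?N" .
  have "?P \<le> (\<integral>\<^sup>+x. ennreal C \<partial>M)"
    by (intro nn_integral_mono) (use e2ennreal_mono[OF le] in auto)
  then have "?P \<le> ennreal C" by (simp add: M)
  then obtain p where p: "?P = ennreal p" "p \<ge> 0"
    by (cases ?P) (auto simp: top_unique)
  show ?thesis
  proof (cases ?I)
    case (real i)
    with eq p have "?N \<noteq> top"
      by (metis ennreal_add_eq_top ennreal_neq_top)
    then obtain n where n: "?N = ennreal n" "n \<ge> 0"
      by (cases ?N) auto
    have "i + p = C + n"
    proof (cases "C \<ge> 0")
      case True
      then have "ennreal (i + p) = ennreal (C + n)"
        using eq real p n by (simp add: ennreal_neg)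
      then show ?thesis
        using True real p n by (subst (asm) ennreal_inj) auto
    next
      case False
      then have "ennreal (i + p + - C) = ennreal n"
        using eq real p n by (subst ennreal_plus) (auto simp: ennreal_neg)
      then show ?thesis
        using False real p n by (subst (asm) ennreal_inj) auto
    qed
    then have "ereal p - ereal n = ereal C - ereal i" by simp
    then show ?thesis
      unfolding ereal_integral_def real(2) p(1) n(1) using real(1) p(2) n(2) by simp
  next
    case top
    with eq have "?N = top"
      by (metis ennreal_add_eq_top ennreal_neq_top)
    with top p show ?thesis
      by (simp add: ereal_integral_def)
  qed
qed

lemma le_ereal_integral_iff:
  assumes M: "emeasure M (space M) = 1" and f: "f \<in> borel_measurable M"
    and le: "\<And>x. x \<in> space M \<Longrightarrow> f x \<le> ereal C" and "y \<le> ereal C"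
  shows "y \<le> ereal_integral M f \<longleftrightarrow>
    (\<integral>\<^sup>+x. e2ennreal (ereal C - f x) \<partial>M) \<le> e2ennreal (ereal C - y)"
proof -
  let ?I = "\<integral>\<^sup>+x. e2ennreal (ereal C - f x) \<partial>M"
  have "y \<le> ereal C - enn2ereal ?I \<longleftrightarrow> ?I \<le> e2ennreal (ereal C - y)"
    using \<open>y \<le> ereal C\<close> by (cases y; cases ?I) (auto simp: top_unique)
  then show ?thesis using ereal_integral_eq_bound_minus[of M f C] M f le by simp
qed

lemma ereal_integral_mono:
  assumes "\<And>x. x \<in> space M \<Longrightarrow> f x \<le> g x"
  shows "ereal_integral M f \<le> ereal_integral M g"
  unfolding ereal_integral_def using assms
  by (intro ereal_minus_mono less_eq_ennreal.rep_eq[THEN iffD1] nn_integral_mono e2ennreal_mono) auto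

section \<open>Upper semicontinuous functions\<close>

lemma usc_on_UNIV_iff: "usc_on UNIV u \<longleftrightarrow> (\<forall>c. open {z. u z < c})"
  by (simp add: usc_on_def)

lemma usc_borel_measurable: "usc_on UNIV u \<Longrightarrow> u \<in> borel_measurable borel"
  unfolding usc_on_UNIV_iff borel_measurable_ereal_iff_Iio
  by (auto simp: vimage_def)

lemma usc_bounded_above_on_compact:
  assumes "usc_on UNIV u" "\<And>z. u z < \<infinity>" "compact S"
  obtains C :: real where "\<And>z. z \<in> S \<Longrightarrow> u z \<le> ereal C"
proof -
  have cover: "S \<subseteq> (\<Union>n::nat. {z. u z < ereal (real n)})"
  proof
    fix z
    have "\<exists>n. u z < ereal (real n)"
      using less_PInf_Ex_of_nat[of "u z"] assms(2)[of z] by simp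
    then show "z \<in> (\<Union>n::nat. {z. u z < ereal (real n)})" by auto
  qed
  have opn: "open {z. u z < ereal (real n)}" if "n \<in> UNIV" for n
    using assms(1) by (simp add: usc_on_UNIV_iff)
  obtain D where D: "finite D" "S \<subseteq> (\<Union>n\<in>D. {z. u z < ereal (real n)})"
    by (rule compactE_image[OF \<open>compact S\<close> opn cover])
  show thesis
  proof (rule that[of "real (Max (insert 0 D))"])
    fix z assume "z \<in> S"
    with D obtain n where n: "n \<in> D" "u z < ereal (real n)" by auto
    have "real n \<le> real (Max (insert 0 D))" using n D by simp
    then show "u z \<le> ereal (real (Max (insert 0 D)))"
      using n(2) by (meson ereal_less_eq(3) less_imp_le order_trans)
  qed
qed

lemma ereal_add_less_split:
  fixes x y c :: ereal
  assumes "x < \<infinity>" "y < \<infinity>" "x + y < c"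
  obtains p q where "x < p" "y < q" "p + q \<le> c"
proof -
  obtain d :: real where d: "x + y < ereal d" "ereal d < c"
    using assms(3) ereal_dense2 by blast
  show thesis
  proof (cases x)
    case (real x') note x = this
    show thesis
    proof (cases y)
      case (real y')
      with x d have "x' + y' < d" by simp
      then show thesis
        using x real d(2)
        by (intro that[of "ereal (x' + (d - x' - y') / 2)" "ereal (y' + (d - x' - y') / 2)"])
           (auto simp: field_simps)
    next
      case MInf
      then show thesis using x d(2)
        by (intro that[of "ereal (x' + 1)" "ereal (d - x' - 1)"]) auto
    qed (use assms in auto)
  next
    case MInf
    show thesis
    proof (cases y)
      case (real y')
      then show thesis using MInf d(2)
        by (intro that[of "ereal (d - y' - 1)" "ereal (y' + 1)"]) auto
    next
      case MInf': MInf
      then show thesis using MInf d(2)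
        by (intro that[of "ereal d" "0"]) auto
    qed (use assms in auto)
  qed (use assms in auto)
qed

lemma usc_add:
  assumes "usc_on UNIV u" "usc_on UNIV v" "\<And>z. u z < \<infinity>" "\<And>z. v z < \<infinity>"
  shows "usc_on UNIV (\<lambda>z. u z + v z)"
  unfolding usc_on_UNIV_iff
proof (rule allI, subst open_subopen, rule ballI)
  fix c z assume "z \<in> {z. u z + v z < c}"
  then obtain p q where pq: "u z < p" "v z < q" "p + q \<le> c"
    using ereal_add_less_split[of "u z" "v z" c] assms(3,4) by blast
  have "u w + v w < c" if "u w < p" "v w < q" for w
    using ereal_add_strict_mono2[of "u w" p "v w" q] that pq by (auto intro: less_le_trans)
  then have "{w. u w < p} \<inter> {w. v w < q} \<subseteq> {z. u z + v z < c}" by auto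
  moreover have "open ({w. u w < p} \<inter> {w. v w < q})"
    using assms(1,2) by (auto simp: usc_on_UNIV_iff)
  ultimately show "\<exists>T. open T \<and> z \<in> T \<and> T \<subseteq> {z. u z + v z < c}"
    using pq by blast
qed

lemma usc_cmult:
  assumes "usc_on UNIV u" "0 < (t::real)"
  shows "usc_on UNIV (\<lambda>z. ereal t * u z)"
proof -
  have "ereal t * u z < c \<longleftrightarrow> u z < c / ereal t" for z c
    using assms(2) by (simp add: ereal_less_divide_pos)
  then show ?thesis using assms(1) by (simp add: usc_on_UNIV_iff)
qed

section \<open>Plurisubharmonic functions on the whole space\<close>

abbreviation circle_measure :: "real measure" where
  "circle_measure \<equiv> uniform_measure lborel {0..2 * pi}"

lemma emeasure_circle_measure: "emeasure circle_measure (space circle_measure) = 1"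
  by (auto simp: emeasure_uniform_measure divide_ennreal)

lemma borel_measurable_circle:
  fixes u :: "complex ^ 'n \<Rightarrow> ereal"
  assumes [measurable]: "u \<in> borel_measurable borel"
  shows "(\<lambda>(b, t). u (a + cis t *s b)) \<in> borel_measurable (lborel \<Otimes>\<^sub>M circle_measure)"
proof -
  have "continuous_on UNIV (\<lambda>p :: (complex ^ 'n) \<times> real. a + cis (snd p) *s fst p)"
    unfolding vector_scalar_mult_def
    by (intro continuous_intros)
  then have "(\<lambda>p :: (complex ^ 'n) \<times> real. a + cis (snd p) *s fst p) \<in> borel_measurable borel"
    by (rule borel_measurable_continuous_onI)
  then have "(\<lambda>p. u (a + cis (snd p) *s fst p)) \<in> borel_measurable borel"
    by (rule measurable_compose) fact
  moreover have "sets (lborel \<Otimes>\<^sub>M circle_measure) = sets (borel :: ((complex ^ 'n) \<times> real) measure)"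
    unfolding borel_prod[symmetric] by (intro sets_pair_measure_cong) auto
  ultimately show ?thesis
    by (simp add: split_beta' cong: measurable_cong_sets)
qed

lemma psh_circle_mean:
  fixes u :: "complex ^ 'n \<Rightarrow> ereal"
  assumes u: "psh_on UNIV u" and C: "\<And>t. u (a + cis t *s b) \<le> ereal C"
  shows "(\<integral>\<^sup>+t. e2ennreal (ereal C - u (a + cis t *s b)) \<partial>circle_measure) \<le> e2ennreal (ereal C - u a)"
    and "u a \<le> ereal C"
proof -
  have m: "(\<lambda>t. u (a + cis t *s b)) \<in> borel_measurable circle_measure"
    using measurable_compose_Pair1[OF _ borel_measurable_circle[OF usc_borel_measurable, of u a], of b] u
    by (simp add: psh_on_def)
  have le: "u a \<le> ereal_integral circle_measure (\<lambda>t. u (a + cis t *s b))"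
    using u by (simp add: psh_on_def)
  also have "\<dots> \<le> ereal C"
    using ereal_integral_eq_bound_minus[OF emeasure_circle_measure m, of C] C
    by (metis enn2ereal_nonneg ereal_diff_le_self)
  finally show "u a \<le> ereal C" .
  with le show "(\<integral>\<^sup>+t. e2ennreal (ereal C - u (a + cis t *s b)) \<partial>circle_measure) \<le> e2ennreal (ereal C - u a)"
    using le_ereal_integral_iff[OF emeasure_circle_measure m, of C "u a"] C by blast
qed

lemma psh_max:
  assumes "psh_on UNIV u" "psh_on UNIV v"
  shows "psh_on UNIV (\<lambda>z. max (u z) (v z))"
  unfolding psh_on_def
proof (intro conjI allI impI ballI)
  have "{z. max (u z) (v z) < c} = {z. u z < c} \<inter> {z. v z < c}" for c by auto
  then show "usc_on UNIV (\<lambda>z. max (u z) (v z))"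
    using assms by (auto simp: psh_on_def usc_on_UNIV_iff)
next
  fix a b
  have "u a \<le> ereal_integral circle_measure (\<lambda>t. u (a + cis t *s b))"
       "v a \<le> ereal_integral circle_measure (\<lambda>t. v (a + cis t *s b))"
    using assms by (simp_all add: psh_on_def)
  then show "max (u a) (v a) \<le> ereal_integral circle_measure (\<lambda>t. max (u (a + cis t *s b)) (v (a + cis t *s b)))"
    by (intro max.boundedI) (erule order_trans, rule ereal_integral_mono, simp)+
next
  show "max (u z) (v z) < \<infinity>" for z
    using assms by (simp add: psh_on_def max_def)
qed auto

lemma psh_bounded_above_on_circle:
  assumes "psh_on UNIV u"
  obtains C :: real where "\<And>t. u (a + cis t *s b) \<le> ereal C"
proof -
  have "continuous_on UNIV (\<lambda>z. a + z *s b)"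
    unfolding vector_scalar_mult_def by (intro continuous_intros)
  then have "compact ((\<lambda>z. a + z *s b) ` sphere 0 1)"
    by (intro compact_continuous_image) (auto intro: continuous_on_subset)
  then obtain C where "\<And>z. z \<in> (\<lambda>z. a + z *s b) ` sphere 0 1 \<Longrightarrow> u z \<le> ereal C"
    using usc_bounded_above_on_compact[of u "(\<lambda>z. a + z *s b) ` sphere 0 1"] assms
    unfolding psh_on_def by blast
  then show thesis by (intro that[of C]) (simp add: image_iff norm_cis Bex_def, metis norm_cis)
qed

text \<open>In terms of defects the circle inequality is additive: if \<open>Cu\<close> and \<open>Cv\<close> bound \<open>u\<close> and \<open>v\<close> on the circle,
  the defect of the combination from \<open>t * Cv + (1 - t) * Cu\<close> is the same combination of
  the defects of \<open>v\<close> and \<open>u\<close>, also at points where one of them is \<open>-\<infinity>\<close>.\<close>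

lemma psh_convex_combination:
  fixes u v :: "complex ^ 'n \<Rightarrow> ereal" and t :: real
  assumes u: "psh_on UNIV u" and v: "psh_on UNIV v" and t: "0 < t" "t < 1"
  shows "psh_on UNIV (\<lambda>z. ereal t * v z + ereal (1 - t) * u z)"
proof -
  let ?w = "\<lambda>z. ereal t * v z + ereal (1 - t) * u z"
  have fin: "u z < \<infinity>" "v z < \<infinity>" for z
    using u v by (auto simp: psh_on_def)
  have scale: "ereal s * x < \<infinity>" if "x < \<infinity>" "0 < s" for s x
    using that by (cases x) auto
  have fin': "ereal t * v z < \<infinity>" "ereal (1 - t) * u z < \<infinity>" for z
    using fin t by (simp_all add: scale)
  have usc: "usc_on UNIV ?w"
    using u v t fin' by (intro usc_add usc_cmult) (auto simp: psh_on_def)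
  have [measurable]: "u \<in> borel_measurable borel" "v \<in> borel_measurable borel" "?w \<in> borel_measurable borel"
    using usc u v by (auto simp: psh_on_def intro: usc_borel_measurable)
  have m: "(\<lambda>s. f (a + cis s *s b)) \<in> borel_measurable circle_measure"
    if "f \<in> borel_measurable borel" for f :: "complex ^ 'n \<Rightarrow> ereal" and a b
    using measurable_compose_Pair1[OF _ borel_measurable_circle[OF that, of a], of b] by simp
  have mean: "?w a \<le> ereal_integral circle_measure (\<lambda>s. ?w (a + cis s *s b))" for a b
  proof -
    obtain Cu where Cu: "\<And>s. u (a + cis s *s b) \<le> ereal Cu"
      using psh_bounded_above_on_circle[OF u] by blast
    obtain Cv where Cv: "\<And>s. v (a + cis s *s b) \<le> ereal Cv"
      using psh_bounded_above_on_circle[OF v] by blast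
    define C where "C = t * Cv + (1 - t) * Cu"
    have split: "e2ennreal (ereal C - (ereal t * y + ereal (1 - t) * x))
        = ennreal t * e2ennreal (ereal Cv - y) + ennreal (1 - t) * e2ennreal (ereal Cu - x)"
      and bound: "ereal t * y + ereal (1 - t) * x \<le> ereal C"
      if "x \<le> ereal Cu" "y \<le> ereal Cv" for x y
    proof -
      have "ereal t * y + ereal (1 - t) * x \<le> ereal t * ereal Cv + ereal (1 - t) * ereal Cu"
        using that t by (intro add_mono ereal_mult_left_mono) auto
      then show "ereal t * y + ereal (1 - t) * x \<le> ereal C" by (simp add: C_def)
      show "e2ennreal (ereal C - (ereal t * y + ereal (1 - t) * x))
        = ennreal t * e2ennreal (ereal Cv - y) + ennreal (1 - t) * e2ennreal (ereal Cu - x)"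
      proof (cases x; cases y)
        fix p q assume xy: "x = ereal p" "y = ereal q"
        have "C - (t * q + (1 - t) * p) = t * (Cv - q) + (1 - t) * (Cu - p)"
          by (simp add: C_def algebra_simps)
        with xy that t show ?thesis
          by (simp add: ennreal_plus ennreal_mult)
      qed (use that t in \<open>auto simp: ennreal_mult_top\<close>)
    qed
    have ua: "u a \<le> ereal Cu" and va: "v a \<le> ereal Cv"
      using psh_circle_mean(2)[OF u Cu] psh_circle_mean(2)[OF v Cv] .
    have [measurable]: "(\<lambda>s. u (a + cis s *s b)) \<in> borel_measurable circle_measure"
       "(\<lambda>s. v (a + cis s *s b)) \<in> borel_measurable circle_measure"
      by (intro m; measurable)+
    have "(\<integral>\<^sup>+s. e2ennreal (ereal C - ?w (a + cis s *s b)) \<partial>circle_measure)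
        = ennreal t * (\<integral>\<^sup>+s. e2ennreal (ereal Cv - v (a + cis s *s b)) \<partial>circle_measure)
          + ennreal (1 - t) * (\<integral>\<^sup>+s. e2ennreal (ereal Cu - u (a + cis s *s b)) \<partial>circle_measure)"
      by (simp add: split[OF Cu Cv] nn_integral_add nn_integral_cmult)
    also have "\<dots> \<le> ennreal t * e2ennreal (ereal Cv - v a) + ennreal (1 - t) * e2ennreal (ereal Cu - u a)"
      by (intro add_mono mult_left_mono psh_circle_mean(1)[OF u Cu] psh_circle_mean(1)[OF v Cv]) auto
    also have "\<dots> = e2ennreal (ereal C - ?w a)"
      by (rule split[OF ua va, symmetric])
    finally show ?thesis
      by (subst le_ereal_integral_iff[OF emeasure_circle_measure, of _ C])
         (auto intro: bound Cu Cv ua va m)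
  qed
  show ?thesis
    unfolding psh_on_def
  proof (intro conjI allI impI ballI)
    show "?w z < \<infinity>" for z using fin'[of z] by (cases "ereal t * v z") auto
  qed (use usc mean in auto)
qed

section \<open>Mean values over balls\<close>

lemma orthogonal_transformation_unit_scalar:
  assumes "cmod c = 1"
  shows "orthogonal_transformation (\<lambda>z :: complex ^ 'n. c *s z)"
  unfolding orthogonal_transformation
proof (intro conjI allI)
  show "linear (\<lambda>z :: complex ^ 'n. c *s z)"
    by (rule linearI) (simp_all add: vec_eq_iff algebra_simps)
  show "norm (c *s z) = norm z" for z :: "complex ^ 'n"
    using assms by (simp add: norm_vec_def norm_mult)
qed

text \<open>Integrate the circle inequality at \<open>z\<close> over all \<open>b\<close> in the ball of radius \<open>s\<close> around the origin and
  exchange the integrals. For each angle the inner integral is the integral over the ball around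
  \<open>z\<close>, because the rotation preserves both the measure and the ball.\<close>

lemma psh_ball_mean_defect:
  fixes u :: "complex ^ 'n \<Rightarrow> ereal"
  assumes u: "psh_on UNIV u" and C: "\<And>x. x \<in> ball z s \<Longrightarrow> u x \<le> ereal C"
  shows "(\<integral>\<^sup>+x. e2ennreal (ereal C - u x) * indicator (ball z s) x \<partial>lborel)
    \<le> emeasure lborel (ball z s) * e2ennreal (ereal C - u z)"
proof -
  define g where "g x = e2ennreal (ereal C - u x) * indicator (ball z s) x" for x
  have [measurable]: "u \<in> borel_measurable borel"
    using u by (auto simp: psh_on_def intro: usc_borel_measurable)
  have [measurable]: "ball z s \<in> sets borel" for z :: "complex ^ 'n" by simp
  have [measurable]: "g \<in> borel_measurable borel"
    unfolding g_def by measurable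
  interpret circ: finite_measure circle_measure
    by (rule finite_measureI) (simp add: emeasure_circle_measure)
  interpret pair_sigma_finite lborel circle_measure
    by (intro pair_sigma_finite.intro sigma_finite_lborel) (rule circ.sigma_finite_measure_axioms)
  have norm_rot: "norm (cis t *s b) = norm b" for t and b :: "complex ^ 'n"
    by (rule orthogonal_transformation_norm[OF orthogonal_transformation_unit_scalar]) simp
  have gm: "(\<lambda>(b, t). g (z + cis t *s b)) \<in> borel_measurable (lborel \<Otimes>\<^sub>M circle_measure)"
  proof -
    have "(\<lambda>x. enn2ereal (g x)) \<in> borel_measurable borel" by measurable
    from borel_measurable_circle[OF this, of z]
    have "(\<lambda>p. e2ennreal (case p of (b, t) \<Rightarrow> enn2ereal (g (z + cis t *s b)))) \<in> borel_measurable (lborel \<Otimes>\<^sub>M circle_measure)"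
      by measurable
    then show ?thesis by (simp add: split_beta')
  qed
  have "(\<integral>\<^sup>+x. g x \<partial>lborel) = (\<integral>\<^sup>+b. g (z + b) \<partial>lborel)"
    by (rule nn_integral_lborel_translation[symmetric]) measurable
  also have "\<dots> = (\<integral>\<^sup>+t. (\<integral>\<^sup>+b. g (z + b) \<partial>lborel) \<partial>circle_measure)"
    using emeasure_circle_measure by simp
  also have "\<dots> = (\<integral>\<^sup>+t. (\<integral>\<^sup>+b. g (z + cis t *s b) \<partial>lborel) \<partial>circle_measure)"
    by (intro nn_integral_cong nn_integral_orthogonal[symmetric] orthogonal_transformation_unit_scalar)
       auto
  also have "\<dots> = (\<integral>\<^sup>+b. (\<integral>\<^sup>+t. g (z + cis t *s b) \<partial>circle_measure) \<partial>lborel)"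
    using gm by (rule Fubini')
  also have "\<dots> \<le> (\<integral>\<^sup>+(b :: complex ^ 'n). e2ennreal (ereal C - u z) * indicator (ball 0 s) b \<partial>lborel)"
  proof (rule nn_integral_mono)
    fix b :: "complex ^ 'n"
    show "(\<integral>\<^sup>+t. g (z + cis t *s b) \<partial>circle_measure) \<le> e2ennreal (ereal C - u z) * indicator (ball 0 s) b"
    proof (cases "norm b < s")
      case True
      then have "z + cis t *s b \<in> ball z s" for t
        by (simp add: dist_norm norm_rot)
      then have "g (z + cis t *s b) = e2ennreal (ereal C - u (z + cis t *s b))"
           "u (z + cis t *s b) \<le> ereal C" for t
        by (auto simp: g_def C)
      then show ?thesis
        using psh_circle_mean(1)[OF u, of z b C] True by simp
    qed (simp add: g_def dist_norm norm_rot)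
  qed
  also have "\<dots> = e2ennreal (ereal C - u z) * emeasure lborel (ball (0 :: complex ^ 'n) s)"
    by (simp add: nn_integral_cmult)
  also have "emeasure lborel (ball (0 :: complex ^ 'n) s) = emeasure lborel (ball z s)"
    using nn_integral_lborel_translation[of "indicator (ball z s)" z]
    by (auto simp: indicator_def dist_norm simp flip: nn_integral_indicator) 
  finally show ?thesis by (simp add: g_def mult.commute)
qed

text \<open>Finiteness at the centre forces integrability over the ball: by \<open>psh_ball_mean_defect\<close> the integral of
  the defect is at most a multiple of its finite value at \<open>z\<close>. From here on real integrals
  can be used, as the value \<open>-\<infinity>\<close>, sent to \<open>0\<close> by \<open>real_of_ereal\<close>, occurs on a null set only.\<close>

lemma psh_ball_mean:
  fixes u :: "complex ^ 'n \<Rightarrow> ereal"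
  assumes u: "psh_on UNIV u" and z: "u z > -\<infinity>"
  shows "set_integrable lborel (ball z s) (\<lambda>x. real_of_ereal (u x))"
    and "AE x in lborel. x \<in> ball z s \<longrightarrow> u x \<noteq> -\<infinity>"
    and "measure lborel (ball z s) * real_of_ereal (u z) \<le> (LINT x:ball z s|lborel. real_of_ereal (u x))"
proof -
  have fin: "u x < \<infinity>" for x
    using u by (simp add: psh_on_def)
  obtain c where c: "u z = ereal c"
    using z fin[of z] by (cases "u z") auto
  have usc: "usc_on UNIV u" using u by (simp add: psh_on_def)
  have [measurable]: "u \<in> borel_measurable borel"
    by (rule usc_borel_measurable[OF usc])
  obtain C0 where "\<And>x. x \<in> cball z s \<Longrightarrow> u x \<le> ereal C0"
    using usc_bounded_above_on_compact[OF usc fin compact_cball] by blast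
  then obtain C where C: "\<And>x. x \<in> ball z s \<Longrightarrow> u x \<le> ereal C" and cC: "c \<le> C"
    by (meson ball_subset_cball ereal_less_eq(3) max.cobounded1 max.cobounded2 order_trans subsetD)
  have [measurable]: "ball z s \<in> sets borel" by simp
  define g where "g x = indicat_real (ball z s) x * (C - real_of_ereal (u x))" for x
  have [measurable]: "g \<in> borel_measurable borel"
    unfolding g_def by measurable
  have ball_fin: "emeasure lborel (ball z s) < \<infinity>"
    by (rule emeasure_lborel_ball_finite)
  then have vol: "emeasure lborel (ball z s) = ennreal (measure lborel (ball z s))"
    by (intro emeasure_eq_ennreal_measure) auto
  have le: "(\<integral>\<^sup>+x. e2ennreal (ereal C - u x) * indicator (ball z s) x \<partial>lborel)
      \<le> ennreal (measure lborel (ball z s) * (C - c))"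
    using psh_ball_mean_defect[of u z s C] u C cC
    by (simp add: vol c ennreal_mult)
  then have "(\<integral>\<^sup>+x. e2ennreal (ereal C - u x) * indicator (ball z s) x \<partial>lborel) \<noteq> \<infinity>"
    by (auto simp: top_unique)
  then have "AE x in lborel. e2ennreal (ereal C - u x) * indicator (ball z s) x \<noteq> \<infinity>"
    by (intro nn_integral_noteq_infinite) auto
  then show ae: "AE x in lborel. x \<in> ball z s \<longrightarrow> u x \<noteq> -\<infinity>"
    by eventually_elim (auto simp: indicator_def)
  have g0: "AE x in lborel. 0 \<le> g x"
    using ae
  proof eventually_elim
    case (elim x)
    then show ?case
      using C[of x] by (cases "u x") (auto simp: g_def indicator_def)
  qed
  have "(\<integral>\<^sup>+x. ennreal (g x) \<partial>lborel)
      = (\<integral>\<^sup>+x. e2ennreal (ereal C - u x) * indicator (ball z s) x \<partial>lborel)"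
  proof (rule nn_integral_cong_AE, use ae in eventually_elim)
    case (elim x)
    then show ?case
      using fin[of x] by (cases "u x") (auto simp: g_def indicator_def)
  qed
  with le have gle: "(\<integral>\<^sup>+x. ennreal (g x) \<partial>lborel) \<le> ennreal (measure lborel (ball z s) * (C - c))"
    by simp
  have gint: "integrable lborel g"
    using gle g0 by (intro integrableI_nonneg) (auto simp: top_unique intro: le_less_trans)
  have "ennreal (integral\<^sup>L lborel g) \<le> ennreal (measure lborel (ball z s) * (C - c))"
    using gle nn_integral_eq_integral[OF gint g0] by simp
  then have gle': "integral\<^sup>L lborel g \<le> measure lborel (ball z s) * (C - c)"
    using cC by (subst (asm) ennreal_le_iff) auto
  have cint: "integrable lborel (\<lambda>x. C * indicat_real (ball z s) x)"
    using ball_fin by (intro integrable_mult_right integrable_real_indicator) auto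
  have eq: "indicat_real (ball z s) x *\<^sub>R real_of_ereal (u x) = C * indicat_real (ball z s) x - g x" for x
    by (simp add: g_def algebra_simps)
  show "set_integrable lborel (ball z s) (\<lambda>x. real_of_ereal (u x))"
    unfolding set_integrable_def eq by (rule Bochner_Integration.integrable_diff[OF cint gint])
  have "(LINT x:ball z s|lborel. real_of_ereal (u x)) = C * measure lborel (ball z s) - integral\<^sup>L lborel g"
    unfolding set_lebesgue_integral_def eq using cint gint by (subst Bochner_Integration.integral_diff) auto
  with gle' show "measure lborel (ball z s) * real_of_ereal (u z) \<le> (LINT x:ball z s|lborel. real_of_ereal (u x))"
    by (simp add: c algebra_simps)
qed

lemma ball_exhaust_integral:
  fixes f :: "'a::euclidean_space \<Rightarrow> real"
  assumes f: "set_integrable lborel (ball a r) f" and "0 < r" "0 < \<epsilon>"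
  obtains \<rho> where "0 < \<rho>" "\<rho> < r" "(LINT x:ball a r - ball a \<rho>|lborel. \<bar>f x\<bar>) < \<epsilon>"
proof -
  define B where "B n = ball a (r - r / real (n + 2))" for n
  have sub: "B n \<subseteq> ball a r" for n
    unfolding B_def using \<open>0 < r\<close> by (intro subset_ball) simp
  have union: "(\<Union>n. B n) = ball a r"
  proof
    show "ball a r \<subseteq> (\<Union>n. B n)"
    proof
      fix x assume "x \<in> ball a r"
      then have pos: "0 < r - dist a x" by simp
      obtain n where "r / (r - dist a x) < real n"
        using reals_Archimedean2 by blast
      then have "r / (r - dist a x) < real (n + 2)" by simp
      then have "r / real (n + 2) < r - dist a x"
        using pos by (simp add: field_simps)
      then have "x \<in> B n" by (simp add: B_def)
      then show "x \<in> (\<Union>n. B n)" by blast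
    qed
  qed (use sub in blast)
  have inc: "incseq B"
    unfolding B_def incseq_def using \<open>0 < r\<close>
    by (intro allI impI subset_ball diff_left_mono divide_left_mono) auto
  have fabs: "set_integrable lborel (ball a r) (\<lambda>x. \<bar>f x\<bar>)"
    using f by (rule set_integrable_abs)
  have lim: "(\<lambda>n. LINT x:B n|lborel. \<bar>f x\<bar>) \<longlonglongrightarrow> (LINT x:(\<Union>n. B n)|lborel. \<bar>f x\<bar>)"
    by (rule set_integral_cont_up) (use inc fabs in \<open>simp_all only: union\<close>, simp add: B_def)
  then have "eventually (\<lambda>n. (LINT x:ball a r|lborel. \<bar>f x\<bar>) - \<epsilon> < (LINT x:B n|lborel. \<bar>f x\<bar>)) sequentially"
    unfolding union using \<open>0 < \<epsilon>\<close> by (intro order_tendstoD(1)) auto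
  then obtain n where n: "(LINT x:ball a r|lborel. \<bar>f x\<bar>) - \<epsilon> < (LINT x:B n|lborel. \<bar>f x\<bar>)"
    by (auto simp: eventually_sequentially)
  have "(LINT x:B n \<union> (ball a r - B n)|lborel. \<bar>f x\<bar>)
      = (LINT x:B n|lborel. \<bar>f x\<bar>) + (LINT x:ball a r - B n|lborel. \<bar>f x\<bar>)"
    by (rule set_integral_Un) (use sub in \<open>auto intro!: set_integrable_subset[OF fabs] simp: B_def\<close>)
  moreover have "B n \<union> (ball a r - B n) = ball a r" using sub by blast
  ultimately have "(LINT x:ball a r - B n|lborel. \<bar>f x\<bar>) < \<epsilon>" using n by simp
  moreover have "0 < r - r / real (n + 2)" "r - r / real (n + 2) < r"
    using \<open>0 < r\<close> by (simp_all add: field_simps add_pos_nonneg)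
  ultimately show thesis unfolding B_def by (intro that)
qed

text \<open>A uniform passage from means to values for the plurisubharmonic functions above a fixed
  \<open>v\<close>. With \<open>s = r - dist a z\<close> the ball of radius \<open>s\<close> around \<open>z\<close> lies in the ball around \<open>a\<close>, and the part of
  the latter that it misses lies outside a ball of radius \<open>\<rho>\<close> around \<open>a\<close>. On that shell \<open>u \<ge> - \<bar>v\<bar>\<close>
  almost everywhere, and \<open>\<rho>\<close> can be chosen so close to \<open>r\<close> that \<open>\<bar>v\<bar>\<close> has integral less than \<open>\<epsilon>\<close> there. Thus
  the integral of \<open>u\<close> over the ball around \<open>z\<close> exceeds the one over the ball around \<open>a\<close> by less than \<open>\<epsilon>\<close>,
  independently of \<open>u\<close>.\<close>

lemma psh_mean_control:
  fixes v :: "complex ^ 'n \<Rightarrow> ereal"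
  assumes v: "psh_on UNIV v" and va: "v a > -\<infinity>" and r: "0 < r" and N: "N < N'"
  obtains d where "0 < d"
    "\<And>u z. psh_on UNIV u \<Longrightarrow> (\<And>x. v x \<le> u x) \<Longrightarrow>
       (LINT x:ball a r|lborel. real_of_ereal (u x)) \<le> measure lborel (ball a r) * N \<Longrightarrow>
       dist a z < d \<Longrightarrow> u z \<le> ereal N'"
proof -
  let ?B = "ball a r"
  let ?V = "\<lambda>x. real_of_ereal (v x)"
  define \<kappa> where "\<kappa> s = s ^ DIM(complex ^ 'n) * measure lborel (ball (0 :: complex ^ 'n) 1)" for s
  have vol: "measure lborel (ball c s) = \<kappa> s" if "0 \<le> s" for c :: "complex ^ 'n" and s
    unfolding \<kappa>_def using that by (rule content_ball_conv_unit_ball)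
  have \<kappa>_pos: "0 < \<kappa> s" if "0 < s" for s
    using content_ball_pos[OF that, of "0 :: complex ^ 'n"] that by (simp add: vol)
  \<comment> \<open>Half of the slack in \<open>N < N'\<close> pays for the shell, the other half for the smaller radius.\<close>
  define \<epsilon> where "\<epsilon> = \<kappa> r * (N' - N) / 2"
  have "0 < \<epsilon>" using \<kappa>_pos[OF r] N by (simp add: \<epsilon>_def)
  note vint = psh_ball_mean(1)[OF v va, of r]
  obtain \<rho> where \<rho>: "0 < \<rho>" "\<rho> < r" "(LINT x:?B - ball a \<rho>|lborel. \<bar>?V x\<bar>) < \<epsilon>"
    using ball_exhaust_integral[OF vint r \<open>0 < \<epsilon>\<close>] .
  have "continuous_on UNIV (\<lambda>\<tau>. \<kappa> (r - \<tau>) * N')"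
    unfolding \<kappa>_def by (intro continuous_intros)
  then have "((\<lambda>\<tau>. \<kappa> (r - \<tau>) * N') \<longlongrightarrow> \<kappa> (r - 0) * N') (at 0)"
    by (simp only: continuous_on_def) blast
  moreover have "\<kappa> r * N + \<epsilon> < \<kappa> (r - 0) * N'"
    using \<kappa>_pos[OF r] N by (simp add: \<epsilon>_def field_simps)
  ultimately have "eventually (\<lambda>\<tau>. \<kappa> r * N + \<epsilon> < \<kappa> (r - \<tau>) * N') (at 0)"
    by (rule order_tendstoD(1))
  then obtain d0 where d0: "0 < d0"
    "\<And>\<tau>. \<tau> \<noteq> 0 \<Longrightarrow> \<bar>\<tau>\<bar> < d0 \<Longrightarrow> \<kappa> r * N + \<epsilon> < \<kappa> (r - \<tau>) * N'"
    by (auto simp: eventually_at dist_real_def)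
  with \<open>\<kappa> r * N + \<epsilon> < \<kappa> (r - 0) * N'\<close>
  have d0': "\<kappa> r * N + \<epsilon> < \<kappa> (r - \<tau>) * N'" if "\<bar>\<tau>\<bar> < d0" for \<tau>
    using that by (cases "\<tau> = 0") auto
  \<comment> \<open>The second bound gives \<open>\<rho> + dist a z < r - dist a z\<close>, so that the ball of radius \<open>\<rho>\<close> around \<open>a\<close> is covered.\<close>
  define d where "d = min d0 ((r - \<rho>) / 2)"
  show thesis
  proof (rule that[of d])
    show "0 < d" using d0 \<rho> by (simp add: d_def)
  next
    fix u :: "complex ^ 'n \<Rightarrow> ereal" and z
    assume u: "psh_on UNIV u" and vu: "\<And>x. v x \<le> u x"
      and mean: "(LINT x:?B|lborel. real_of_ereal (u x)) \<le> measure lborel ?B * N"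
      and z: "dist a z < d"
    let ?U = "\<lambda>x. real_of_ereal (u x)"
    define s where "s = r - dist a z"
    have s: "\<rho> + dist a z < s" "0 < s" "s \<le> r"
      using z \<rho> by (auto simp: d_def s_def)
    have inner: "ball a \<rho> \<subseteq> ball z s"
    proof
      fix x assume "x \<in> ball a \<rho>"
      then show "x \<in> ball z s"
        using dist_triangle[of z x a] s by (simp add: dist_commute)
    qed
    have outer: "ball z s \<subseteq> ?B"
    proof
      fix x assume "x \<in> ball z s"
      then show "x \<in> ?B"
        using dist_triangle[of a x z] by (simp add: s_def)
    qed
    have ufin: "u x < \<infinity>" for x using u by (simp add: psh_on_def)
    show "u z \<le> ereal N'"
    proof (cases "u z = -\<infinity>")
      case False
      then obtain c where c: "u z = ereal c" using ufin[of z] by (cases "u z") auto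
      have ua: "u a > -\<infinity>" using va vu[of a] by (rule less_le_trans)
      note uint = psh_ball_mean(1)[OF u ua, of r]
      let ?D = "?B - ball z s"
      have uD: "set_integrable lborel ?D ?U" and vD: "set_integrable lborel ?D ?V"
        and uz: "set_integrable lborel (ball z s) ?U"
        and vB: "set_integrable lborel (?B - ball a \<rho>) ?V"
        using outer by (auto intro: set_integrable_subset[OF uint] set_integrable_subset[OF vint])
      have "\<kappa> s * c \<le> (LINT x:ball z s|lborel. ?U x)"
        using psh_ball_mean(3)[OF u, of z s] s by (simp add: c vol)
      also have "\<dots> = (LINT x:?B|lborel. ?U x) - (LINT x:?D|lborel. ?U x)"
      proof -
        have "(LINT x:ball z s \<union> ?D|lborel. ?U x) = (LINT x:ball z s|lborel. ?U x) + (LINT x:?D|lborel. ?U x)"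
          by (rule set_integral_Un) (use uD uz in auto)
        moreover have "ball z s \<union> ?D = ?B" using outer by blast
        ultimately show ?thesis by simp
      qed
      also have "\<dots> \<le> \<kappa> r * N + \<epsilon>"
      proof -
        have "- (LINT x:?B - ball a \<rho>|lborel. \<bar>?V x\<bar>) \<le> - (LINT x:?D|lborel. \<bar>?V x\<bar>)"
          unfolding neg_le_iff_le set_lebesgue_integral_def
        proof (rule integral_mono)
          show "indicat_real ?D x *\<^sub>R \<bar>?V x\<bar> \<le> indicat_real (?B - ball a \<rho>) x *\<^sub>R \<bar>?V x\<bar>" for x
            by (rule scaleR_right_mono[OF _ abs_ge_zero]) (use inner in \<open>auto simp: indicator_def\<close>)
        qed (use set_integrable_abs[OF vD] set_integrable_abs[OF vB] in \<open>simp_all add: set_integrable_def\<close>)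
        also have "\<dots> = (LINT x:?D|lborel. - \<bar>?V x\<bar>)"
          by (simp add: set_lebesgue_integral_def)
        also have "\<dots> \<le> (LINT x:?D|lborel. ?U x)"
        proof (rule set_integral_mono_AE)
          show "AE x \<in> ?D in lborel. - \<bar>?V x\<bar> \<le> ?U x"
            using psh_ball_mean(2)[OF v va, of r]
          proof eventually_elim
            case (elim x)
            show ?case
            proof
              assume "x \<in> ?D"
              with elim vu[of x] ufin[of x] show "- \<bar>?V x\<bar> \<le> ?U x"
                by (cases "u x"; cases "v x") auto
            qed
          qed
          show "set_integrable lborel ?D (\<lambda>x. - \<bar>?V x\<bar>)"
            using set_integrable_abs[OF vD] by (simp add: set_integrable_def)
        qed (rule uD)
        finally show ?thesis using \<rho>(3) mean r by (simp add: vol)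
      qed
      also have "\<dots> < \<kappa> s * N'"
        unfolding s_def using z by (intro d0') (simp add: d_def)
      finally have "c < N'" using \<kappa>_pos[OF \<open>0 < s\<close>] by simp
      then show ?thesis by (simp add: c)
    qed simp
  qed
qed

section \<open>Extremal functions and their regularizations\<close>

lemma log_plus_nonneg: "0 \<le> log_plus x"
  by (simp add: log_plus_def)

lemma Lelong_class_mono:
  assumes "\<mu> \<le> \<delta>" shows "Lelong_class \<mu> \<subseteq> Lelong_class \<delta>"
proof
  fix u :: "complex ^ 'n \<Rightarrow> ereal" assume "u \<in> Lelong_class \<mu>"
  then obtain C where u: "psh_on UNIV u" and C: "\<And>z. u z \<le> ereal (\<mu> * log_plus (norm z) + C)"
    by (auto simp: Lelong_class_def)
  have "u z \<le> ereal (\<delta> * log_plus (norm z) + C)" for z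
    by (rule order_trans[OF C]) (simp add: assms mult_right_mono log_plus_nonneg)
  with u show "u \<in> Lelong_class \<delta>" by (auto simp: Lelong_class_def)
qed

lemma Lelong_class_max:
  assumes "u \<in> Lelong_class \<delta>" "v \<in> Lelong_class \<delta>"
  shows "(\<lambda>z. max (u z) (v z)) \<in> Lelong_class \<delta>"
proof -
  obtain C D where C: "\<And>z. u z \<le> ereal (\<delta> * log_plus (norm z) + C)"
    and D: "\<And>z. v z \<le> ereal (\<delta> * log_plus (norm z) + D)"
    using assms by (auto simp: Lelong_class_def)
  have "max (u z) (v z) \<le> ereal (\<delta> * log_plus (norm z) + max C D)" for z
    by (intro max.boundedI order_trans[OF C] order_trans[OF D]) auto
  with assms psh_max show ?thesis by (auto simp: Lelong_class_def)
qed

lemma Lelong_class_convex_combination: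
  assumes u: "u \<in> Lelong_class \<nu>" and v: "v \<in> Lelong_class \<mu>" and t: "0 < t" "t < 1"
  shows "(\<lambda>z. ereal t * v z + ereal (1 - t) * u z) \<in> Lelong_class (t * \<mu> + (1 - t) * \<nu>)"
proof -
  obtain C D where C: "\<And>z. u z \<le> ereal (\<nu> * log_plus (norm z) + C)"
    and D: "\<And>z. v z \<le> ereal (\<mu> * log_plus (norm z) + D)"
    using u v by (auto simp: Lelong_class_def)
  have "ereal t * v z + ereal (1 - t) * u z
      \<le> ereal ((t * \<mu> + (1 - t) * \<nu>) * log_plus (norm z) + (t * D + (1 - t) * C))" for z
  proof -
    have "ereal t * v z + ereal (1 - t) * u z
        \<le> ereal t * ereal (\<mu> * log_plus (norm z) + D) + ereal (1 - t) * ereal (\<nu> * log_plus (norm z) + C)"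
      using t by (intro add_mono ereal_mult_left_mono C D) auto
    then show ?thesis by (simp add: algebra_simps)
  qed
  with u v t psh_convex_combination show ?thesis by (auto simp: Lelong_class_def)
qed

lemma extremal_fun_mono:
  assumes "\<mu> \<le> \<delta>" shows "extremal_fun \<mu> K \<psi> z \<le> extremal_fun \<delta> K \<psi> z"
  unfolding extremal_fun_def using Lelong_class_mono[OF assms] by (intro SUP_subset_mono) auto

lemma extremal_fun_reg_mono:
  assumes "\<mu> \<le> \<delta>" shows "extremal_fun_reg \<mu> K \<psi> z \<le> extremal_fun_reg \<delta> K \<psi> z"
  unfolding extremal_fun_reg_def usc_reg_def
  by (intro Limsup_mono always_eventually allI extremal_fun_mono assms)

lemma usc_reg_ge: "f z \<le> usc_reg f z"
  unfolding usc_reg_def Limsup_def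
  by (intro INF_greatest) (auto intro: SUP_upper dest: eventually_nhds_x_imp_x)

text \<open>The instance of concavity of the regularized extremal function in its index that the theorem needs:
  if it equals \<open>c\<close> at \<open>\<delta>\<close> and is at least \<open>c\<close> at a smaller index \<open>\<mu>\<close>, it is at most \<open>c\<close> at
  every larger index \<open>\<nu>\<close>. Asking for the value \<open>c\<close> of the unregularized function at \<open>\<mu>\<close> supplies a single
  competitor \<open>v\<close> with \<open>v a\<close> close to \<open>c\<close>, against which all competitors at \<open>\<nu>\<close> are compared.\<close>

lemma extremal_fun_reg_concavity:
  fixes K :: "(complex ^ 'n) set"
  assumes order: "\<mu> < \<delta>" "\<delta> < \<nu>"
    and \<mu>: "extremal_fun \<mu> K \<psi> a = ereal c"
    and \<delta>: "extremal_fun_reg \<delta> K \<psi> a = ereal c"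
  shows "extremal_fun_reg \<nu> K \<psi> a \<le> ereal c"
proof (rule ereal_le_epsilon2)
  fix e :: real assume "0 < e"
  define t where "t = (\<nu> - \<delta>) / (\<nu> - \<mu>)"
  have t: "0 < t" "t < 1" using order by (simp_all add: t_def field_simps)
  have t\<delta>: "t * \<mu> + (1 - t) * \<nu> = \<delta>"
  proof -
    have "t * (\<nu> - \<mu>) = \<nu> - \<delta>" using order by (simp add: t_def)
    then show ?thesis by (simp add: algebra_simps)
  qed
  \<comment> \<open>Small enough that the bound \<open>N\<close> on the means, at most \<open>c + \<eta> * (1 + t) / (1 - t)\<close>, stays below \<open>c + e\<close>.\<close>
  define \<eta> where "\<eta> = e * (1 - t) / 4"
  have \<eta>: "0 < \<eta>" using \<open>0 < e\<close> t by (simp add: \<eta>_def)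
  have "ereal (c - \<eta>) < extremal_fun \<mu> K \<psi> a" using \<mu> \<eta> by simp
  then obtain v where v: "v \<in> Lelong_class \<mu>" "\<And>x. x \<in> K \<Longrightarrow> v x \<le> ereal (\<psi> x)"
    and va: "ereal (c - \<eta>) < v a"
    unfolding extremal_fun_def less_SUP_iff by auto
  have vpsh: "psh_on UNIV v" using v by (simp add: Lelong_class_def)
  have va': "v a > -\<infinity>" using va by (cases "v a") auto
  obtain c' where c': "v a = ereal c'"
    using va vpsh by (cases "v a") (auto simp: psh_on_def)
  have "eventually (\<lambda>x. extremal_fun \<delta> K \<psi> x < ereal (c + \<eta>)) (nhds a)"
    using \<delta> \<eta> by (intro Limsup_lessD) (simp add: extremal_fun_reg_def usc_reg_def)
  then obtain r where r: "0 < r" "\<And>x. dist x a < r \<Longrightarrow> extremal_fun \<delta> K \<psi> x < ereal (c + \<eta>)"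
    by (auto simp: eventually_nhds_metric)
  let ?B = "ball a r"
  define N where "N = ((c + \<eta>) - t * c') / (1 - t)"
  have "N < c + e"
  proof -
    have "t * (c - \<eta>) < t * c'" using va c' t by simp
    then have "t * c - t * \<eta> < t * c'" by (simp add: algebra_simps)
    moreover have "t * \<eta> < \<eta>" using t \<eta> by simp
    moreover have "(c + e) * (1 - t) = c - t * c + 4 * \<eta>"
      by (simp add: \<eta>_def field_simps)
    ultimately have "(c + \<eta>) - t * c' < (c + e) * (1 - t)"
      using \<eta> by linarith
    then show ?thesis using t by (simp add: N_def field_simps)
  qed
  then obtain d where d: "0 < d"
    "\<And>u z. psh_on UNIV u \<Longrightarrow> (\<And>x. v x \<le> u x) \<Longrightarrow>
       (LINT x:?B|lborel. real_of_ereal (u x)) \<le> measure lborel ?B * N \<Longrightarrow>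
       dist a z < d \<Longrightarrow> u z \<le> ereal (c + e)"
    using psh_mean_control[OF vpsh va' r(1)] by metis
  have bound: "u z \<le> ereal (c + e)"
    if u: "u \<in> Lelong_class \<nu>" "\<And>x. x \<in> K \<Longrightarrow> u x \<le> ereal (\<psi> x)" and z: "dist a z < d" for u z
  proof -
    \<comment> \<open>Taking the maximum with \<open>v\<close> gives a larger competitor for the same index, bounded below by \<open>v\<close>.\<close>
    define w where "w x = max (u x) (v x)" for x
    have w: "w \<in> Lelong_class \<nu>" and wK: "\<And>x. x \<in> K \<Longrightarrow> w x \<le> ereal (\<psi> x)"
      using Lelong_class_max[OF u(1), of v] v u(2) Lelong_class_mono[of \<mu> \<nu>] order
      by (auto simp: w_def[abs_def])
    have wpsh: "psh_on UNIV w" using w by (simp add: Lelong_class_def)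
    have vw: "v x \<le> w x" for x by (simp add: w_def)
    have wa: "w a > -\<infinity>" using va' vw[of a] by (rule less_le_trans)
    have comb: "ereal t * v x + ereal (1 - t) * w x \<le> ereal (c + \<eta>)" if "x \<in> ?B" for x
    proof -
      have "ereal t * v y + ereal (1 - t) * w y \<le> ereal (\<psi> y)" if "y \<in> K" for y
      proof -
        have "ereal t * v y + ereal (1 - t) * w y \<le> ereal t * ereal (\<psi> y) + ereal (1 - t) * ereal (\<psi> y)"
          using t v(2)[OF that] wK[OF that] by (intro add_mono ereal_mult_left_mono) auto
        then show ?thesis by (simp add: algebra_simps)
      qed
      then have "ereal t * v x + ereal (1 - t) * w x \<le> extremal_fun \<delta> K \<psi> x"
        unfolding extremal_fun_def
        using Lelong_class_convex_combination[OF w v(1) t] t\<delta>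
        by (intro SUP_upper2[of "\<lambda>x. ereal t * v x + ereal (1 - t) * w x"]) auto
      also have "\<dots> \<le> ereal (c + \<eta>)"
        using r(2)[of x] that by (simp add: dist_commute less_imp_le)
      finally show ?thesis .
    qed
    note vB = psh_ball_mean[OF vpsh va', of r] and wB = psh_ball_mean[OF wpsh wa, of r]
    have "t * (measure lborel ?B * c') + (1 - t) * (LINT x:?B|lborel. real_of_ereal (w x))
        \<le> t * (LINT x:?B|lborel. real_of_ereal (v x)) + (1 - t) * (LINT x:?B|lborel. real_of_ereal (w x))"
      using vB(3) t by (simp add: c')
    also have "\<dots> = (LINT x:?B|lborel. t * real_of_ereal (v x) + (1 - t) * real_of_ereal (w x))"
      using vB(1) wB(1) by (subst set_integral_add) auto
    also have "\<dots> \<le> (LINT x:?B|lborel. c + \<eta>)"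
    proof (rule set_integral_mono_AE)
      show "AE x\<in>?B in lborel. t * real_of_ereal (v x) + (1 - t) * real_of_ereal (w x) \<le> c + \<eta>"
        using vB(2) wB(2)
      proof eventually_elim
        case (elim x)
        show ?case
        proof
          assume x: "x \<in> ?B"
          moreover have "v x < \<infinity>" "w x < \<infinity>" using vpsh wpsh by (auto simp: psh_on_def)
          ultimately show "t * real_of_ereal (v x) + (1 - t) * real_of_ereal (w x) \<le> c + \<eta>"
            using comb[OF x] elim by (cases "v x"; cases "w x") auto
        qed
      qed
      show "set_integrable lborel ?B (\<lambda>x. c + \<eta>)"
        using emeasure_lborel_ball_finite[of a r]
        by (simp add: set_integrable_def)
    qed (use vB(1) wB(1) in auto)
    also have "\<dots> = measure lborel ?B * (c + \<eta>)"
      by (simp add: set_lebesgue_integral_def)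
    finally have "(1 - t) * (LINT x:?B|lborel. real_of_ereal (w x)) \<le> measure lborel ?B * ((c + \<eta>) - t * c')"
      by (simp add: algebra_simps)
    then have "(LINT x:?B|lborel. real_of_ereal (w x)) \<le> measure lborel ?B * N"
      using t by (simp add: N_def field_simps)
    then have "w z \<le> ereal (c + e)"
      using d(2)[OF wpsh vw _ z] by blast
    then show ?thesis by (simp add: w_def)
  qed
  have "eventually (\<lambda>z. extremal_fun \<nu> K \<psi> z \<le> ereal (c + e)) (nhds a)"
    unfolding eventually_nhds_metric
  proof (intro exI[of _ d] conjI allI impI)
    fix z assume "dist z a < d"
    then show "extremal_fun \<nu> K \<psi> z \<le> ereal (c + e)"
      unfolding extremal_fun_def by (intro SUP_least) (auto simp: dist_commute intro: bound)
  qed (rule d)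
  then show "extremal_fun_reg \<nu> K \<psi> a \<le> ereal c + ereal e"
    unfolding extremal_fun_reg_def usc_reg_def by (intro Limsup_bounded) simp
qed

text \<open>Below \<open>\<delta>\<close> this is monotonicity in the index, above \<open>\<delta>\<close> it is concavity, which needs the smaller index \<open>\<mu>\<close>.
  When \<open>\<Lambda> = {l..}\<close>, the index \<open>\<delta> = l\<close> admits no such \<open>\<mu>\<close>; this leaves room for the exceptional value \<open>{l}\<close>.\<close>

lemma extremal_fun_reg_attained_transfer:
  assumes "\<mu> \<in> Lambda K \<psi>" "\<mu> < \<delta>" and \<delta>: "extremal_fun_reg \<delta> K \<psi> a = ereal (\<psi> a)"
    and \<nu>: "\<nu> \<in> Lambda K \<psi>" and a: "a \<in> K"
  shows "extremal_fun_reg \<nu> K \<psi> a = ereal (\<psi> a)"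
proof (rule antisym)
  show "ereal (\<psi> a) \<le> extremal_fun_reg \<nu> K \<psi> a"
    using usc_reg_ge[of "extremal_fun \<nu> K \<psi>" a] \<nu> a by (simp add: extremal_fun_reg_def Lambda_def)
  show "extremal_fun_reg \<nu> K \<psi> a \<le> ereal (\<psi> a)"
  proof (cases "\<nu> \<le> \<delta>")
    case True
    then show ?thesis using extremal_fun_reg_mono[of \<nu> \<delta> K \<psi> a] \<delta> by simp
  next
    case False
    then show ?thesis
      using assms by (intro extremal_fun_reg_concavity[of \<mu> \<delta>]) (auto simp: Lambda_def)
  qed
qed

lemma Lambda_reg_at_eq_Lambda:
  assumes "\<mu> \<in> Lambda K \<psi>" "\<mu> < \<delta>" "\<delta> \<in> Lambda_reg_at a K \<psi>" "a \<in> K"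
  shows "Lambda_reg_at a K \<psi> = Lambda K \<psi>"
  using assms extremal_fun_reg_attained_transfer[of \<mu> K \<psi> \<delta> a]
  by (auto simp: Lambda_reg_at_def)

lemma Lambda_reg_eq_Lambda:
  assumes "\<mu> \<in> Lambda K \<psi>" "\<mu> < \<delta>" "\<delta> \<in> Lambda_reg K \<psi>"
  shows "Lambda_reg K \<psi> = Lambda K \<psi>"
  using assms extremal_fun_reg_attained_transfer[of \<mu> K \<psi> \<delta>]
  by (auto simp: Lambda_reg_def)

theorem theorem1p1:
  fixes K :: "(complex ^ 'n) set" and \<psi> :: "complex ^ 'n \<Rightarrow> real"
  assumes "compact K" and "\<not> pluripolar K" and "bounded (\<psi> ` K)" and "Lambda K \<psi> \<noteq> {}"
  shows "(\<forall>l>0. Lambda K \<psi> = {l..} \<longrightarrow>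
           (\<forall>a\<in>K. Lambda_reg_at a K \<psi> \<in> {{}, {l}, {l..}}) \<and>
           Lambda_reg K \<psi> \<in> {{}, {l}, {l..}}) \<and>
         (Lambda K \<psi> = {0<..} \<longrightarrow>
           (\<forall>a\<in>K. Lambda_reg_at a K \<psi> \<in> {{}, {0<..}}) \<and> Lambda_reg K \<psi> \<in> {{}, {0<..}})"
proof -
  have closed: "R \<in> {{}, {l}, {l..}}"
    if R: "R \<subseteq> {l..}" "\<And>\<mu> \<delta>. \<mu> \<in> {l..} \<Longrightarrow> \<mu> < \<delta> \<Longrightarrow> \<delta> \<in> R \<Longrightarrow> R = {l..}" for R and l :: real
  proof (cases "R \<subseteq> {l}")
    case False
    with R(1) obtain \<delta> where "\<delta> \<in> R" "l < \<delta>" by force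
    with R(2)[of l \<delta>] show ?thesis by simp
  qed auto
  have open': "R \<in> {{}, {0<..}}"
    if R: "\<And>\<mu> \<delta>. \<mu> \<in> {0<..} \<Longrightarrow> \<mu> < \<delta> \<Longrightarrow> \<delta> \<in> R \<Longrightarrow> R = {0<..}" "R \<subseteq> {0<..}" for R :: "real set"
  proof (cases "R = {}")
    case False
    then obtain \<delta> where "\<delta> \<in> R" "0 < \<delta>" using R(2) by force
    with R(1)[of "\<delta> / 2" \<delta>] show ?thesis by simp
  qed auto
  have sub: "Lambda_reg_at a K \<psi> \<subseteq> Lambda K \<psi>" "Lambda_reg K \<psi> \<subseteq> Lambda K \<psi>" for a
    by (auto simp: Lambda_reg_at_def Lambda_reg_def)
  show ?thesis
  proof (intro conjI allI impI ballI)
    fix l :: real assume L: "Lambda K \<psi> = {l..}"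
    show "Lambda_reg_at a K \<psi> \<in> {{}, {l}, {l..}}" if "a \<in> K" for a
      using Lambda_reg_at_eq_Lambda[of _ K \<psi> _ a] that sub unfolding L by (intro closed) auto
    show "Lambda_reg K \<psi> \<in> {{}, {l}, {l..}}"
      using Lambda_reg_eq_Lambda[of _ K \<psi>] sub unfolding L by (intro closed) auto
  next
    assume L: "Lambda K \<psi> = {0<..}"
    show "Lambda_reg_at a K \<psi> \<in> {{}, {0<..}}" if "a \<in> K" for a
      using Lambda_reg_at_eq_Lambda[of _ K \<psi> _ a] that sub unfolding L by (intro open') auto
    show "Lambda_reg K \<psi> \<in> {{}, {0<..}}"
      using Lambda_reg_eq_Lambda[of _ K \<psi>] sub unfolding L by (intro open') auto
  qed
qed
end
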